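(* Let $l,m,N\ge1$ be integers, let $\mathcal R:\mathbb R^l\to\mathbb R^m$ be a linear restriction operator, and let $\mathcal L:\mathbb R^m\to\mathbb R^l$ and $\mathcal M:\mathbb R^m\times\mathbb R^l\to\mathbb R^l$ be arbitrary lifting and matching maps. Let $A_{\mathcal F}\in\mathbb R^{l\times l}$, $A_{\mathcal C}\in\mathbb R^{m\times m}$ be constant matrices, let $B_{\mathcal F}$, $B_{\mathcal C}$ be functions of time with values in $\mathbb R^l$, $\mathbb R^m$, and let the fine and coarse propagators over one step of length $\Delta t$ be affine: $\mathcal F(u,t)=A_{\mathcal F}u+B_{\mathcal F}(t)$ and $\mathcal C(U,t)=A_{\mathcal C}U+B_{\mathcal C}(t)$. Let $U^k_n\in\mathbb R^m$ and $u^k_n\in\mathbb R^l$ be the macro and micro iterates of the micro-macro Parareal algorithm (see context) with initial values $U_0$, $u_0$, and let $u_n$ be the fine solution, $u_n=A_{\mathcal F}u_{n-1}+B_{\mathcal F}(t_n)$ for $1\le n\le N$. Put $e^k_n=u^k_n-u_n$ and $E^k_n=U^k_n-\mathcal R u_n$. Then for all $k\ge0$ and $1\le n\le N$, $$U^{k+1}_n=\mathcal R A_{\mathcal F}u^k_{n-1}+\mathcal R B_{\mathcal F}(t_n)+\sum_{p=1}^{n-1}A_{\mathcal C}^{\,n-p}\Big(\mathcal R A_{\mathcal F}u^k_{p-1}+\mathcal R B_{\mathcal F}(t_p)-U^k_p\Big),$$ and $$E^{k+1}_n=\mathcal R A_{\mathcal F}e^k_{n-1}+\sum_{p=1}^{n-1}A_{\mathcal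 C}^{\,n-p}\Big(\mathcal R A_{\mathcal F}e^k_{p-1}-E^k_p\Big)=\sum_{p=1}^{n-1}A_{\mathcal C}^{\,n-p-1}\Big(\mathcal R A_{\mathcal F}e^k_p-A_{\mathcal C}E^k_p\Big).$$
   Context: Time grid: $t_n=n\Delta t$, $0\le n\le N$. Convention: the step from $t_{n-1}$ to $t_n$ uses the inhomogeneities $B_{\mathcal F}(t_n)$ and $B_{\mathcal C}(t_n)$. Micro-macro Parareal: for $1\le n\le N$, initialization $U^0_0=U_0$, $U^0_n=\mathcal C(U^0_{n-1},t_n)$, $u^0_0=u_0$, $u^0_n=\mathcal L(U^0_n)$; and for $k\ge0$, $U^{k+1}_0=U_0$, $u^{k+1}_0=u_0$, $$U^{k+1}_n=\mathcal C(U^{k+1}_{n-1},t_n)+\mathcal R\big(\mathcal F(u^k_{n-1},t_n)\big)-\mathcal C(U^k_{n-1},t_n),\qquad u^{k+1}_n=\mathcal M\big(U^{k+1}_n,\mathcal F(u^k_{n-1},t_n)\big).$$ Empty sums are zero. *)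

theory Defs
  imports "HOL-Analysis.Analysis"
begin

text \<open>The overloaded \<open>^\<close> on \<^typ>\<open>real ^ 'n ^ 'n\<close> is the power for the entrywise product,
  so the power for the matrix product is defined separately.\<close>

primrec matpow :: "real ^ 'n ^ 'n \<Rightarrow> nat \<Rightarrow> real ^ 'n ^ 'n" where
  "matpow A 0 = mat 1"
| "matpow A (Suc k) = A ** matpow A k"

text \<open>Superscripts come first: \<open>U k n\<close> is the macro iterate $U^k_n$ and \<open>u k n\<close> the micro iterate
  $u^k_n$. The state space of \<open>U\<close> is \<open>'c\<close>, that of \<open>u\<close> is \<open>'f\<close>; the values of \<open>U\<close> and \<open>u\<close> at
  \<open>n > N\<close> are left unconstrained. The step from $t_{n-1}$ to $t_n$ evaluates the propagators
  at time $t_n$.\<close>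

definition micro_macro_parareal ::
  "('c::ab_group_add \<Rightarrow> real \<Rightarrow> 'c) \<Rightarrow> ('f \<Rightarrow> real \<Rightarrow> 'f) \<Rightarrow> ('f \<Rightarrow> 'c) \<Rightarrow> ('c \<Rightarrow> 'f) \<Rightarrow> ('c \<Rightarrow> 'f \<Rightarrow> 'f)
    \<Rightarrow> (nat \<Rightarrow> real) \<Rightarrow> nat \<Rightarrow> 'c \<Rightarrow> 'f \<Rightarrow> (nat \<Rightarrow> nat \<Rightarrow> 'c) \<Rightarrow> (nat \<Rightarrow> nat \<Rightarrow> 'f) \<Rightarrow> bool" where
  "micro_macro_parareal C F R L M t N U0 u0 U u \<longleftrightarrow>
     U 0 0 = U0 \<and> u 0 0 = u0 \<and>
     (\<forall>n\<in>{1..N}. U 0 n = C (U 0 (n - 1)) (t n) \<and> u 0 n = L (U 0 n)) \<and>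
     (\<forall>k. U (Suc k) 0 = U0 \<and> u (Suc k) 0 = u0 \<and>
       (\<forall>n\<in>{1..N}.
          U (Suc k) n = C (U (Suc k) (n - 1)) (t n) + R (F (u k (n - 1)) (t n)) - C (U k (n - 1)) (t n) \<and>
          u (Suc k) n = M (U (Suc k) n) (F (u k (n - 1)) (t n))))"

end

theory Submission
  imports Defs
begin

text \<open>For fixed \<open>k\<close> the macro correction is the linear recursion
  $V_n = g_n + A_C (V_{n-1} - W_{n-1})$ with $V_n = U^{k+1}_n$, $W_n = U^k_n$ and
  $g_n = R F(u^k_{n-1}, t_n)$; the inhomogeneity of the coarse propagator cancels, and so does
  the initial value because $V_0 = W_0$. Unrolling gives the formula for the iterates. Since
  $R u_p = R A_F u_{p-1} + R B_F(t_p)$ for the fine solution, subtracting it turns iterates into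
  errors, and the last form follows by shifting the index, using $e^k_0 = 0$.\<close>

text \<open>Every index satisfies \<open>p \<le> n\<close>, so the truncated subtraction gives
  \<open>Suc n - p = Suc (n - p)\<close> and one factor \<open>A\<close> leaves each term on the
  left.\<close>

lemma sum_matpow_Suc:
  "(\<Sum>p = 1..n. matpow A (Suc n - p) *v x p) = A *v (\<Sum>p = 1..n. matpow A (n - p) *v x p)"
proof -
  have "matpow A (Suc n - p) *v x p = A *v (matpow A (n - p) *v x p)" if "p \<in> {1..n}" for p
    using that by (simp add: Suc_diff_le matrix_vector_mul_assoc)
  then show ?thesis
    by (simp add: linear_sum[OF matrix_vector_mul_linear])
qed

text \<open>Horner's scheme: the last term carries the power 0 and all others share a factor
  \<open>A\<close>. This is the form in which the sums enter inductions.\<close>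

lemma sum_matpow_horner:
  "(\<Sum>p = 1..Suc n. matpow A (Suc n - p) *v x p)
    = x (Suc n) + A *v (\<Sum>p = 1..n. matpow A (n - p) *v x p)"
  unfolding sum_matpow_Suc[symmetric] by simp

lemma affine_correction_unroll:
  fixes A :: "real ^ 'n ^ 'n"
  assumes rec: "\<And>j. j < N \<Longrightarrow> V (Suc j) = g (Suc j) + A *v (V j - W j)"
    and init: "V 0 = W 0" and "n < N"
  shows "V (Suc n) = g (Suc n) + (\<Sum>p = 1..n. matpow A (Suc n - p) *v (g p - W p))"
  using \<open>n < N\<close>
proof (induction n)
  case 0
  then show ?case using rec[of 0] init by simp
next
  case (Suc n)
  \<comment> \<open>Subtracting \<open>W (Suc n)\<close> from the induction hypothesis turns its
    leading \<open>g (Suc n)\<close> into the missing summand \<open>p = Suc n\<close>, with power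
    0.\<close>
  then have "V (Suc n) - W (Suc n) = (\<Sum>p = 1..Suc n. matpow A (Suc n - p) *v (g p - W p))"
    by simp
  then show ?case
    unfolding sum_matpow_Suc using rec[OF Suc.prems] by (simp only:)
qed

text \<open>With \<open>q = p - 1\<close> the power at \<open>h q\<close> becomes
  \<open>n - q\<close>. The separate \<open>h n\<close> supplies \<open>q = n\<close>, and the term
  \<open>q = 0\<close> vanishes by assumption.\<close>

lemma sum_matpow_index_shift:
  fixes A :: "real ^ 'n ^ 'n"
  assumes "h 0 = 0"
  shows "h n + (\<Sum>p = 1..n. matpow A (Suc n - p) *v (h (p - 1) - D p))
    = (\<Sum>p = 1..n. matpow A (n - p) *v (h p - A *v D p))"
proof (induction n)
  case 0
  then show ?case using assms by simp
next
  case (Suc n)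
  \<comment> \<open>Both sides obey
    \<open>S (Suc n) = h (Suc n) - A *v D (Suc n) + A *v S n\<close>; here this is shown for the
    left one.\<close>
  have "h (Suc n) + (\<Sum>p = 1..Suc n. matpow A (Suc (Suc n) - p) *v (h (p - 1) - D p))
      = h (Suc n) - A *v D (Suc n)
        + A *v (h n + (\<Sum>p = 1..n. matpow A (Suc n - p) *v (h (p - 1) - D p)))"
    unfolding sum_matpow_Suc[of A "Suc n"] sum_matpow_horner sum_matpow_Suc[of A n]
    by (simp add: matrix_vector_right_distrib matrix_vector_mult_diff_distrib)
  then show ?case
    unfolding Suc.IH sum_matpow_horner by simp
qed

theorem lemma4:
  fixes R :: "real ^ 'l \<Rightarrow> real ^ 'm"
    and L :: "real ^ 'm \<Rightarrow> real ^ 'l"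
    and M :: "real ^ 'm \<Rightarrow> real ^ 'l \<Rightarrow> real ^ 'l"
    and A\<^sub>F :: "real ^ 'l ^ 'l" and A\<^sub>C :: "real ^ 'm ^ 'm"
    and B\<^sub>F :: "real \<Rightarrow> real ^ 'l" and B\<^sub>C :: "real \<Rightarrow> real ^ 'm"
    and F :: "real ^ 'l \<Rightarrow> real \<Rightarrow> real ^ 'l"
    and C :: "real ^ 'm \<Rightarrow> real \<Rightarrow> real ^ 'm"
    and \<Delta>t :: real and t :: "nat \<Rightarrow> real" and N :: nat
    and U0 :: "real ^ 'm" and u0 :: "real ^ 'l"
    and U E :: "nat \<Rightarrow> nat \<Rightarrow> real ^ 'm"
    and u e :: "nat \<Rightarrow> nat \<Rightarrow> real ^ 'l"
    and ufine :: "nat \<Rightarrow> real ^ 'l"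
  assumes "N \<ge> 1"
    and "linear R"
    and "\<And>v s. F v s = A\<^sub>F *v v + B\<^sub>F s"
    and "\<And>V s. C V s = A\<^sub>C *v V + B\<^sub>C s"
    and "\<And>n. n \<le> N \<Longrightarrow> t n = real n * \<Delta>t"
    and "micro_macro_parareal C F R L M t N U0 u0 U u"
    and "ufine 0 = u0"
    and "\<And>n. 1 \<le> n \<Longrightarrow> n \<le> N \<Longrightarrow> ufine n = A\<^sub>F *v ufine (n - 1) + B\<^sub>F (t n)"
    and "\<And>k n. n \<le> N \<Longrightarrow> e k n = u k n - ufine n"
    and "\<And>k n. n \<le> N \<Longrightarrow> E k n = U k n - R (ufine n)"
  shows "\<forall>k. \<forall>n\<in>{1..N}.
      U (k + 1) n = R (A\<^sub>F *v u k (n - 1)) + R (B\<^sub>F (t n))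
        + (\<Sum>p = 1..n - 1. matpow A\<^sub>C (n - p) *v
             (R (A\<^sub>F *v u k (p - 1)) + R (B\<^sub>F (t p)) - U k p))
    \<and> E (k + 1) n = R (A\<^sub>F *v e k (n - 1))
        + (\<Sum>p = 1..n - 1. matpow A\<^sub>C (n - p) *v (R (A\<^sub>F *v e k (p - 1)) - E k p))
    \<and> R (A\<^sub>F *v e k (n - 1))
        + (\<Sum>p = 1..n - 1. matpow A\<^sub>C (n - p) *v (R (A\<^sub>F *v e k (p - 1)) - E k p))
      = (\<Sum>p = 1..n - 1. matpow A\<^sub>C (n - p - 1) *v (R (A\<^sub>F *v e k p) - A\<^sub>C *v E k p))"
proof (intro allI ballI)
  fix k n
  assume "n \<in> {1..N}"
  then obtain m where n: "n = Suc m" and "m < N"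
    by (cases n) auto
  note R_add = linear_add[OF \<open>linear R\<close>] and R_diff = linear_diff[OF \<open>linear R\<close>]
  have init: "U j 0 = U0" "u j 0 = u0" for j
    using assms(6) unfolding micro_macro_parareal_def by (cases j; simp)+
  define g where "g p = R (A\<^sub>F *v u k (p - 1)) + R (B\<^sub>F (t p))" for p
  define h where "h p = R (A\<^sub>F *v e k p)" for p
  have "U (Suc k) (Suc j) = g (Suc j) + A\<^sub>C *v (U (Suc k) j - U k j)" if "j < N" for j
  proof -
    have "U (Suc k) (Suc j)
        = C (U (Suc k) j) (t (Suc j)) + R (F (u k j) (t (Suc j))) - C (U k j) (t (Suc j))"
      using assms(6) that unfolding micro_macro_parareal_def by force
    then show ?thesis
      by (simp add: assms(3,4) g_def R_add matrix_vector_mult_diff_distrib)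
  qed
  then have U: "U (Suc k) (Suc m)
      = g (Suc m) + (\<Sum>p = 1..m. matpow A\<^sub>C (Suc m - p) *v (g p - U k p))"
    using affine_correction_unroll[of N "U (Suc k)" g A\<^sub>C "U k"] init \<open>m < N\<close> by simp
  have g: "g p = h (p - 1) + R (ufine p)" if "1 \<le> p" "p \<le> N" for p
    using assms(8)[OF that] assms(9)[of "p - 1" k] that
    by (simp add: g_def h_def R_add R_diff matrix_vector_mult_diff_distrib)
  \<comment> \<open>Inside the sum the restricted fine values cancel; the one left in
    \<open>g (Suc m)\<close> is absorbed by \<open>E (Suc k) (Suc m)\<close>.\<close>
  have "g p - U k p = h (p - 1) - E k p" if "p \<in> {1..m}" for p
    using g[of p] assms(10)[of p k] that \<open>m < N\<close> by simp
  then have E: "E (Suc k) (Suc m)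
      = h m + (\<Sum>p = 1..m. matpow A\<^sub>C (Suc m - p) *v (h (p - 1) - E k p))"
    using U g[of "Suc m"] assms(10)[of "Suc m" "Suc k"] \<open>m < N\<close> by simp
  \<comment> \<open>Every micro iterate starts at \<open>u0 = ufine 0\<close>, so
    \<open>e k 0 = 0\<close>.\<close>
  have "h 0 = 0"
    using assms(7,9) init linear_0[OF \<open>linear R\<close>] by (simp add: h_def)
  from U E sum_matpow_index_shift[of h, OF this, of m A\<^sub>C "E k"]
  show "U (k + 1) n = R (A\<^sub>F *v u k (n - 1)) + R (B\<^sub>F (t n))
        + (\<Sum>p = 1..n - 1. matpow A\<^sub>C (n - p) *v
             (R (A\<^sub>F *v u k (p - 1)) + R (B\<^sub>F (t p)) - U k p))
    \<and> E (k + 1) n = R (A\<^sub>F *v e k (n - 1))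
        + (\<Sum>p = 1..n - 1. matpow A\<^sub>C (n - p) *v (R (A\<^sub>F *v e k (p - 1)) - E k p))
    \<and> R (A\<^sub>F *v e k (n - 1))
        + (\<Sum>p = 1..n - 1. matpow A\<^sub>C (n - p) *v (R (A\<^sub>F *v e k (p - 1)) - E k p))
      = (\<Sum>p = 1..n - 1. matpow A\<^sub>C (n - p - 1) *v (R (A\<^sub>F *v e k p) - A\<^sub>C *v E k p))"
    by (simp add: n g_def h_def)
qed

end
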